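(* There are no $D$-minimal CR-submanifolds $(M^{d+l},g)$ in $\mathbb{C}^q$ (where $D=\bar J(TM)\cap TM$) with any of the following properties: (a) $\delta^+_{\mathrm{m},D}(n_1,\ldots,n_k)>0$ for some $(n_1,\ldots,n_k)$ with $\sum_i n_i=d$; (b) $\delta^-_{\mathrm{m},D}(k)>0$ for some $k\ge2$.
   Context: $\mathbb{C}^q$ carries its standard flat Hermitian structure, with complex structure $\bar J$. A submanifold $M^{d+l}$ ($d,l>0$) of $\mathbb{C}^q$ with the induced metric $g$ is a CR-submanifold if $D=\bar J(TM)\cap TM$ (the maximal $\bar J$-invariant subbundle of $TM$) is a distribution of constant real dimension $d$. With $h$ the second fundamental form of $M$ and $\{e_i\}$ an orthonormal basis of $D_x$, put $H_{D_x}=\sum_i h(e_i,e_i)$; $M$ is $D$-minimal if $H_D\equiv0$. Mutual curvature: with $R_{X,Y}=\nabla_X\nabla_Y-\nabla_Y\nabla_X-\nabla_{[X,Y]}$ the curvature tensor of $g$, for mutually orthogonal subspaces $V_1,\ldots,V_k$ ($k\ge2$) of $T_xM$ put $\mathrm{S}_{\mathrm{m}}(V_1,\ldots,V_k)=\sum_{i<j}\mathrm{S}_{\mathrm{m}}(V_i,V_j)$, where $\mathrm{S}_{\mathrm{m}}(V_i,V_j)=\sum_{a,b}g(R_{e_a,e_b}e_b,e_a)$, $\{e_a\}$ being an orthonormal basis of $V_i$ and $\{e_b\}$ an orthonormal basis of $V_j$. For $k\ge 2$ and positive integers $n_1,\ldots,n_k$ with $\sum_in_i\le d$, $\delta^+_{\mathrm{m},D}(n_1,\ldots,n_k)(x)$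 and $\delta^-_{\mathrm{m},D}(n_1,\ldots,n_k)(x)$ are the maximum and the minimum of $\mathrm{S}_{\mathrm{m}}(V_1,\ldots,V_k)$ over all mutually orthogonal subspaces $V_1,\ldots,V_k$ of $D_x$ with $\dim V_i=n_i$. For $2\le k\le d$, $\delta^-_{\mathrm{m},D}(k)=\min\delta^-_{\mathrm{m},D}(n_1,\ldots,n_k)$ over all $k$-tuples of positive integers with $\sum_in_i\le d$. These are functions on $M$, and ``$>0$'' refers to positivity of the function on $M$. *)

theory Defs
  imports "HOL-Analysis.Analysis"
begin

text \<open>On an open set of a Euclidean space this is the usual \<open>C\<^sup>k\<close>: all iterated directional
  derivatives up to order \<open>k\<close> exist (as values of Frechet derivatives) and are continuous.\<close>

primrec Ck_on :: "nat \<Rightarrow> 'a::euclidean_space set \<Rightarrow> ('a \<Rightarrow> 'b::real_normed_vector) \<Rightarrow> bool" where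
  "Ck_on 0 S f \<longleftrightarrow> continuous_on S f"
| "Ck_on (Suc k) S f \<longleftrightarrow>
     (\<forall>x\<in>S. f differentiable (at x)) \<and>
     (\<forall>v. Ck_on k S (\<lambda>x. frechet_derivative f (at x) v))"

definition smooth_on :: "'a::euclidean_space set \<Rightarrow> ('a \<Rightarrow> 'b::real_normed_vector) \<Rightarrow> bool" where
  "smooth_on S f \<longleftrightarrow> (\<forall>k. Ck_on k S f)"

text \<open>Charts are given through their inverses: a pair \<open>(U, \<phi>)\<close> stands for a homeomorphism \<open>\<phi>\<close>
  from an open set \<open>U\<close> of the model space \<open>'n\<close> onto an open set of the manifold. The dimension of
  the manifold is \<open>DIM('n)\<close>.\<close>

type_synonym ('n, 'm) param = "'n set \<times> ('n \<Rightarrow> 'm)"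

definition smooth_manifold :: "'m topology \<Rightarrow> ('n::euclidean_space, 'm) param set \<Rightarrow> bool" where
  "smooth_manifold M A \<longleftrightarrow>
     topspace M \<noteq> {} \<and> Hausdorff_space M \<and> second_countable M \<and>
     (\<forall>(U, \<phi>)\<in>A. open U \<and> openin M (\<phi> ` U) \<and>
        homeomorphic_map (top_of_set U) (subtopology M (\<phi> ` U)) \<phi>) \<and>
     (\<Union>(U, \<phi>)\<in>A. \<phi> ` U) = topspace M \<and>
     (\<forall>(U, \<phi>)\<in>A. \<forall>(V, \<psi>)\<in>A. smooth_on {u \<in> U. \<phi> u \<in> \<psi> ` V} (inv_into V \<psi> \<circ> \<phi>))"

definition smooth_immersion ::
    "('n::euclidean_space, 'm) param set \<Rightarrow> ('m \<Rightarrow> 'e::euclidean_space) \<Rightarrow> bool" where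
  "smooth_immersion A f \<longleftrightarrow>
     (\<forall>(U, \<phi>)\<in>A. smooth_on U (f \<circ> \<phi>) \<and> (\<forall>p\<in>U. inj (frechet_derivative (f \<circ> \<phi>) (at p))))"

definition immersed_submanifold ::
    "'m topology \<Rightarrow> ('n::euclidean_space, 'm) param set \<Rightarrow> ('m \<Rightarrow> 'e::euclidean_space) \<Rightarrow> bool" where
  "immersed_submanifold M A f \<longleftrightarrow> smooth_manifold M A \<and> smooth_immersion A f"

text \<open>The geometric objects at a point \<open>x\<close> are computed in some chart around \<open>x\<close>; none of them
  depends on the choice of this chart.\<close>

definition chart_at :: "('n, 'm) param set \<Rightarrow> 'm \<Rightarrow> ('n, 'm) param" where
  "chart_at A x = (SOME (U, \<phi>). (U, \<phi>) \<in> A \<and> x \<in> \<phi> ` U)"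

definition coord_at :: "('n, 'm) param set \<Rightarrow> 'm \<Rightarrow> 'n" where
  "coord_at A x = (case chart_at A x of (U, \<phi>) \<Rightarrow> inv_into U \<phi> x)"

definition local_immersion :: "('n, 'm) param set \<Rightarrow> ('m \<Rightarrow> 'e) \<Rightarrow> 'm \<Rightarrow> 'n \<Rightarrow> 'e" where
  "local_immersion A f x = f \<circ> snd (chart_at A x)"

definition tangent_map ::
    "('n::euclidean_space, 'm) param set \<Rightarrow> ('m \<Rightarrow> 'e::euclidean_space) \<Rightarrow> 'm \<Rightarrow> 'n \<Rightarrow> 'e" where
  "tangent_map A f x = frechet_derivative (local_immersion A f x) (at (coord_at A x))"

text \<open>Tangent vectors at \<open>x\<close> are identified with their images in the ambient space; the induced
  metric \<open>g\<close> on them is then the ambient inner product.\<close>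

definition tangent_space ::
    "('n::euclidean_space, 'm) param set \<Rightarrow> ('m \<Rightarrow> 'e::euclidean_space) \<Rightarrow> 'm \<Rightarrow> 'e set" where
  "tangent_space A f x = range (tangent_map A f x)"

definition coord_vec ::
    "('n::euclidean_space, 'm) param set \<Rightarrow> ('m \<Rightarrow> 'e::euclidean_space) \<Rightarrow> 'm \<Rightarrow> 'e \<Rightarrow> 'n" where
  "coord_vec A f x X = inv (tangent_map A f x) X"

definition normal_part :: "'e::euclidean_space set \<Rightarrow> 'e \<Rightarrow> 'e" where
  "normal_part T w = (THE n. w - n \<in> T \<and> (\<forall>t\<in>T. orthogonal n t))"

text \<open>\<open>h(X, Y)\<close> is the normal component of the flat derivative in direction \<open>X\<close> of a tangent field
  extending \<open>Y\<close>; here \<open>Y\<close> is extended with constant coefficients in the chart.\<close>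

definition second_fundamental_form ::
    "('n::euclidean_space, 'm) param set \<Rightarrow> ('m \<Rightarrow> 'e::euclidean_space) \<Rightarrow> 'm \<Rightarrow> 'e \<Rightarrow> 'e \<Rightarrow> 'e" where
  "second_fundamental_form A f x X Y =
     normal_part (tangent_space A f x)
       (frechet_derivative
          (\<lambda>p. frechet_derivative (local_immersion A f x) (at p) (coord_vec A f x Y))
          (at (coord_at A x)) (coord_vec A f x X))"

text \<open>A metric in a chart is a function \<open>g\<close> with \<open>g p u v\<close> the product of \<open>u\<close> and \<open>v\<close> at \<open>p\<close>.
  \<open>christoffel g p u v\<close> is the vector \<open>\<Gamma>\<^sub>p(u, v)\<close> whose components are
  \<open>\<Sum>i j. \<Gamma>\<^sup>k\<^sub>i\<^sub>j(p) u\<^sup>i v\<^sup>j\<close>, written without a basis.\<close>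

definition christoffel :: "('n::euclidean_space \<Rightarrow> 'n \<Rightarrow> 'n \<Rightarrow> real) \<Rightarrow> 'n \<Rightarrow> 'n \<Rightarrow> 'n \<Rightarrow> 'n" where
  "christoffel g p u v = (THE w. \<forall>z. g p w z =
     (frechet_derivative (\<lambda>q. g q v z) (at p) u
      + frechet_derivative (\<lambda>q. g q u z) (at p) v
      - frechet_derivative (\<lambda>q. g q u v) (at p) z) / 2)"

definition levi_civita ::
    "('n::euclidean_space \<Rightarrow> 'n \<Rightarrow> 'n \<Rightarrow> real) \<Rightarrow> ('n \<Rightarrow> 'n) \<Rightarrow> ('n \<Rightarrow> 'n) \<Rightarrow> 'n \<Rightarrow> 'n" where
  "levi_civita g X Y = (\<lambda>p. frechet_derivative Y (at p) (X p) + christoffel g p (X p) (Y p))"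

definition lie_bracket ::
    "('n::euclidean_space \<Rightarrow> 'n) \<Rightarrow> ('n \<Rightarrow> 'n) \<Rightarrow> 'n \<Rightarrow> 'n" where
  "lie_bracket X Y =
     (\<lambda>p. frechet_derivative Y (at p) (X p) - frechet_derivative X (at p) (Y p))"

definition curvature_operator ::
    "('n::euclidean_space \<Rightarrow> 'n \<Rightarrow> 'n \<Rightarrow> real) \<Rightarrow>
     ('n \<Rightarrow> 'n) \<Rightarrow> ('n \<Rightarrow> 'n) \<Rightarrow> ('n \<Rightarrow> 'n) \<Rightarrow> 'n \<Rightarrow> 'n" where
  "curvature_operator g X Y Z = (\<lambda>p.
     levi_civita g X (levi_civita g Y Z) p
     - levi_civita g Y (levi_civita g X Z) p
     - levi_civita g (lie_bracket X Y) Z p)"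

definition induced_metric ::
    "('n::euclidean_space \<Rightarrow> 'e::euclidean_space) \<Rightarrow> 'n \<Rightarrow> 'n \<Rightarrow> 'n \<Rightarrow> real" where
  "induced_metric F p u v = frechet_derivative F (at p) u \<bullet> frechet_derivative F (at p) v"

text \<open>The value \<open>R\<^bsub>X,Y\<^esub>Z\<close> at \<open>x\<close> for tangent vectors \<open>X, Y, Z\<close> at \<open>x\<close>; by tensoriality any extension
  to vector fields may be used, and we take constant coefficients in the chart.\<close>

definition curvature_tensor ::
    "('n::euclidean_space, 'm) param set \<Rightarrow> ('m \<Rightarrow> 'e::euclidean_space) \<Rightarrow> 'm
      \<Rightarrow> 'e \<Rightarrow> 'e \<Rightarrow> 'e \<Rightarrow> 'e" where
  "curvature_tensor A f x X Y Z =
     tangent_map A f x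
       (curvature_operator (induced_metric (local_immersion A f x))
          (\<lambda>_. coord_vec A f x X) (\<lambda>_. coord_vec A f x Y) (\<lambda>_. coord_vec A f x Z)
          (coord_at A x))"

text \<open>For vectors in \<open>complex ^ 'q\<close> the inner product is the real part of the standard Hermitian
  form, and \<open>dim\<close>, \<open>subspace\<close>, \<open>span\<close> refer to the real vector space structure.\<close>

definition cplx_J :: "complex ^ 'q \<Rightarrow> complex ^ 'q" where
  "cplx_J v = \<i> *s v"

definition holomorphic_distribution ::
    "('n::euclidean_space, 'm) param set \<Rightarrow> ('m \<Rightarrow> complex ^ 'q) \<Rightarrow> 'm \<Rightarrow> (complex ^ 'q) set" where
  "holomorphic_distribution A f x = cplx_J ` tangent_space A f x \<inter> tangent_space A f x"

text \<open>Smoothness of \<open>D\<close> is not required separately: \<open>D\<close> is the kernel of the smooth bundle map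
  sending a tangent vector \<open>X\<close> to the normal component of \<open>J X\<close>, so it is a smooth subbundle as
  soon as its rank is constant.\<close>

definition CR_submanifold ::
    "nat \<Rightarrow> nat \<Rightarrow> 'm topology \<Rightarrow> ('n::euclidean_space, 'm) param set
      \<Rightarrow> ('m \<Rightarrow> complex ^ 'q) \<Rightarrow> bool" where
  "CR_submanifold d l M A f \<longleftrightarrow>
     immersed_submanifold M A f \<and> 0 < d \<and> 0 < l \<and> DIM('n) = d + l \<and>
     (\<forall>x\<in>topspace M. dim (holomorphic_distribution A f x) = d)"

definition orthonormal_basis :: "'e::euclidean_space set \<Rightarrow> 'e set \<Rightarrow> bool" where
  "orthonormal_basis V B \<longleftrightarrow>
     B \<subseteq> V \<and> pairwise orthogonal B \<and> (\<forall>e\<in>B. norm e = 1) \<and> span B = V"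

text \<open>The sums below do not depend on the orthonormal bases chosen.\<close>

definition some_onb :: "'e::euclidean_space set \<Rightarrow> 'e set" where
  "some_onb V = (SOME B. orthonormal_basis V B)"

definition H_D ::
    "('n::euclidean_space, 'm) param set \<Rightarrow> ('m \<Rightarrow> complex ^ 'q) \<Rightarrow> 'm \<Rightarrow> complex ^ 'q" where
  "H_D A f x =
     (\<Sum>e\<in>some_onb (holomorphic_distribution A f x). second_fundamental_form A f x e e)"

definition D_minimal ::
    "'m topology \<Rightarrow> ('n::euclidean_space, 'm) param set \<Rightarrow> ('m \<Rightarrow> complex ^ 'q) \<Rightarrow> bool" where
  "D_minimal M A f \<longleftrightarrow> (\<forall>x\<in>topspace M. H_D A f x = 0)"

definition mutual_curvature2 ::
    "('n::euclidean_space, 'm) param set \<Rightarrow> ('m \<Rightarrow> 'e::euclidean_space) \<Rightarrow> 'm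
      \<Rightarrow> 'e set \<Rightarrow> 'e set \<Rightarrow> real" where
  "mutual_curvature2 A f x V W =
     (\<Sum>a\<in>some_onb V. \<Sum>b\<in>some_onb W. curvature_tensor A f x a b b \<bullet> a)"

definition mutual_curvature ::
    "('n::euclidean_space, 'm) param set \<Rightarrow> ('m \<Rightarrow> 'e::euclidean_space) \<Rightarrow> 'm
      \<Rightarrow> 'e set list \<Rightarrow> real" where
  "mutual_curvature A f x Vs =
     (\<Sum>j<length Vs. \<Sum>i<j. mutual_curvature2 A f x (Vs ! i) (Vs ! j))"

definition orthogonal_subspaces ::
    "'e::euclidean_space set \<Rightarrow> nat list \<Rightarrow> 'e set list \<Rightarrow> bool" where
  "orthogonal_subspaces D ns Vs \<longleftrightarrow>
     length Vs = length ns \<and>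
     (\<forall>i<length ns. subspace (Vs ! i) \<and> Vs ! i \<subseteq> D \<and> dim (Vs ! i) = ns ! i) \<and>
     (\<forall>i<length ns. \<forall>j<length ns. i \<noteq> j \<longrightarrow>
        (\<forall>u\<in>Vs ! i. \<forall>v\<in>Vs ! j. orthogonal u v))"

text \<open>The supremum and infimum are attained, since the admissible families of subspaces form a
  compact space, nonempty when \<open>sum_list ns \<le> dim D\<close>, on which the mutual curvature is
  continuous.\<close>

definition delta_max ::
    "('n::euclidean_space, 'm) param set \<Rightarrow> ('m \<Rightarrow> complex ^ 'q) \<Rightarrow> nat list \<Rightarrow> 'm \<Rightarrow> real" where
  "delta_max A f ns x =
     Sup (mutual_curvature A f x `
       {Vs. orthogonal_subspaces (holomorphic_distribution A f x) ns Vs})"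

definition delta_min ::
    "('n::euclidean_space, 'm) param set \<Rightarrow> ('m \<Rightarrow> complex ^ 'q) \<Rightarrow> nat list \<Rightarrow> 'm \<Rightarrow> real" where
  "delta_min A f ns x =
     Inf (mutual_curvature A f x `
       {Vs. orthogonal_subspaces (holomorphic_distribution A f x) ns Vs})"

definition positive_tuples :: "nat \<Rightarrow> nat \<Rightarrow> nat list set" where
  "positive_tuples d k = {ns. length ns = k \<and> (\<forall>n\<in>set ns. 0 < n) \<and> sum_list ns \<le> d}"

definition delta_min_k ::
    "nat \<Rightarrow> ('n::euclidean_space, 'm) param set \<Rightarrow> ('m \<Rightarrow> complex ^ 'q) \<Rightarrow> nat \<Rightarrow> 'm \<Rightarrow> real" where
  "delta_min_k d A f k x = Min ((\<lambda>ns. delta_min A f ns x) ` positive_tuples d k)"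

end

theory Submission
  imports Defs
begin

text \<open>At any point \<open>x\<close> the Gauss equation gives
  \<open>R\<^bsub>a,b\<^esub>b \<bullet> a = h(a, a) \<bullet> h(b, b) - (norm (h(a, b)))\<^sup>2\<close>. If \<open>D\<close> is the orthogonal sum of
  \<open>V\<^sub>1, \<dots>, V\<^sub>k\<close>, the traces \<open>H\<^sub>i\<close> of \<open>h\<close> over \<open>V\<^sub>i\<close> add up to \<open>H\<^sub>D = 0\<close>, so the mutual curvature
  is at most \<open>\<Sum>i<j. H\<^sub>i \<bullet> H\<^sub>j = - (\<Sum>i. (norm H\<^sub>i)\<^sup>2) / 2 \<le> 0\<close>. Hence
  \<open>\<delta>\<^sup>+(n\<^sub>1, \<dots>, n\<^sub>k) \<le> 0\<close> whenever \<open>n\<^sub>1 + \<dots> + n\<^sub>k = d\<close>, and then also \<open>\<delta>\<^sup>-(k) \<le> 0\<close>. The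
  submanifold is nonempty, so positivity fails at some point.\<close>

subsection \<open>Symmetry of mixed derivatives and linear systems depending on a parameter\<close>

lemma smooth_on_differentiable:
  assumes "smooth_on S f" "x \<in> S"
  shows "f differentiable (at x)"
  using assms unfolding smooth_on_def by (metis Ck_on.simps(2))

lemma smooth_on_frechet_derivative:
  assumes "smooth_on S f"
  shows "smooth_on S (\<lambda>x. frechet_derivative f (at x) v)"
  using assms unfolding smooth_on_def by (metis Ck_on.simps(2))

lemma smooth_on_continuous_on: "smooth_on S f \<Longrightarrow> continuous_on S f"
  unfolding smooth_on_def by (metis Ck_on.simps(1))

lemma smooth_on_has_derivative:
  assumes "smooth_on S f" "x \<in> S"
  shows "(f has_derivative frechet_derivative f (at x)) (at x)"
  using smooth_on_differentiable[OF assms] frechet_derivative_works by blast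

section \<open>Symmetry of mixed derivatives through second differences\<close>

lemma has_real_derivative_along_line:
  fixes f :: "'a::real_normed_vector \<Rightarrow> real"
  assumes "(f has_derivative f') (at (p + t *\<^sub>R v))"
  shows "((\<lambda>s. f (p + s *\<^sub>R v)) has_real_derivative f' v) (at t)"
proof -
  have "((\<lambda>s. f (p + s *\<^sub>R v)) has_derivative (\<lambda>s. f' (s *\<^sub>R v))) (at t)"
    by (rule has_derivative_compose[of "\<lambda>s. p + s *\<^sub>R v" _ _ _ f])
       (auto intro!: derivative_eq_intros assms)
  moreover have "f' (s *\<^sub>R v) = f' v * s" for s
    using linear_cmul[OF has_derivative_linear[OF assms]] by simp
  ultimately show ?thesis
    by (simp add: has_field_derivative_def)
qed

text \<open>Two mean value arguments, first in direction \<open>u\<close> and then in direction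
  \<open>v\<close>. The second difference on the left is symmetric in \<open>u\<close> and
  \<open>v\<close>, while the right side shows the derivatives in one particular order.\<close>

lemma second_difference_mean_value:
  fixes f :: "'a::real_normed_vector \<Rightarrow> real"
  assumes h: "0 < h"
    and S: "\<And>s t. \<lbrakk>0 \<le> s; s \<le> h; 0 \<le> t; t \<le> h\<rbrakk> \<Longrightarrow> p + s *\<^sub>R u + t *\<^sub>R v \<in> S"
    and f: "\<And>x. x \<in> S \<Longrightarrow> (f has_derivative f' x) (at x)"
    and fu: "\<And>x. x \<in> S \<Longrightarrow> ((\<lambda>x. f' x u) has_derivative fu' x) (at x)"
  obtains s t where "0 < s" "s < h" "0 < t" "t < h"
    "f (p + h *\<^sub>R u + h *\<^sub>R v) - f (p + h *\<^sub>R u) - f (p + h *\<^sub>R v) + f p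
      = h * h * fu' (p + s *\<^sub>R u + t *\<^sub>R v) v"
proof -
  \<comment> \<open>\<open>\<psi>\<close> is the increment in direction
    \<open>h *\<^sub>R v\<close>, so that the second difference is
    \<open>\<psi> h - \<psi> 0\<close>.\<close>
  define \<psi> where "\<psi> s = f (p + h *\<^sub>R v + s *\<^sub>R u) - f (p + s *\<^sub>R u)" for s
  have "(\<psi> has_real_derivative f' (p + h *\<^sub>R v + s *\<^sub>R u) u - f' (p + s *\<^sub>R u) u) (at s)"
    if "0 \<le> s" "s \<le> h" for s
    unfolding \<psi>_def
    using that h S[of s h] S[of s 0]
    by (intro DERIV_diff has_real_derivative_along_line f) (auto simp: algebra_simps)
  then obtain s where s: "0 < s" "s < h"
      "\<psi> h - \<psi> 0 = (h - 0) * (f' (p + h *\<^sub>R v + s *\<^sub>R u) u - f' (p + s *\<^sub>R u) u)"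
    using MVT2[of 0 h \<psi> "\<lambda>s. f' (p + h *\<^sub>R v + s *\<^sub>R u) u - f' (p + s *\<^sub>R u) u"] h by blast
  have "((\<lambda>t. f' (p + s *\<^sub>R u + t *\<^sub>R v) u) has_real_derivative fu' (p + s *\<^sub>R u + t *\<^sub>R v) v) (at t)"
    if "0 \<le> t" "t \<le> h" for t
    using that s S[of s t]
    by (intro has_real_derivative_along_line[of "\<lambda>x. f' x u"] fu) auto
  then obtain t where t: "0 < t" "t < h"
      "f' (p + s *\<^sub>R u + h *\<^sub>R v) u - f' (p + s *\<^sub>R u + 0 *\<^sub>R v) u
        = (h - 0) * fu' (p + s *\<^sub>R u + t *\<^sub>R v) v"
    using MVT2[of 0 h "\<lambda>t. f' (p + s *\<^sub>R u + t *\<^sub>R v) u"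
        "\<lambda>t. fu' (p + s *\<^sub>R u + t *\<^sub>R v) v"] h by blast
  have "\<psi> h - \<psi> 0 = h * h * fu' (p + s *\<^sub>R u + t *\<^sub>R v) v"
    using s(3) t(3) by (simp add: algebra_simps)
  then show thesis
    using s t by (intro that[of s t]) (auto simp: \<psi>_def algebra_simps)
qed

text \<open>The same second difference is \<open>h * h\<close> times either mixed derivative, each
  at some point near \<open>p\<close>. Continuity of both at \<open>p\<close> then leaves no room
  for a gap between their values there.\<close>

lemma symmetric_mixed_derivative_real:
  fixes f :: "'a::real_normed_vector \<Rightarrow> real"
  assumes S: "open S" "p \<in> S"
    and f: "\<And>x. x \<in> S \<Longrightarrow> (f has_derivative f' x) (at x)"
    and fu: "\<And>x. x \<in> S \<Longrightarrow> ((\<lambda>x. f' x u) has_derivative fu' x) (at x)"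
    and fv: "\<And>x. x \<in> S \<Longrightarrow> ((\<lambda>x. f' x v) has_derivative fv' x) (at x)"
    and cu: "continuous_on S (\<lambda>x. fu' x v)"
    and cv: "continuous_on S (\<lambda>x. fv' x u)"
  shows "fu' p v = fv' p u"
proof (rule ccontr)
  assume ne: "fu' p v \<noteq> fv' p u"
  \<comment> \<open>Half the gap: two numbers within \<open>e\<close> of a common value are closer
    to each other than the gap.\<close>
  define e where "e = \<bar>fu' p v - fv' p u\<bar> / 2"
  have e: "0 < e" using ne by (simp add: e_def)
  obtain r0 where r0: "0 < r0" "ball p r0 \<subseteq> S"
    using S open_contains_ball by blast
  obtain r1 where r1: "0 < r1" "\<And>x. x \<in> S \<Longrightarrow> dist x p < r1 \<Longrightarrow> dist (fu' x v) (fu' p v) < e"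
    using cu S(2) e unfolding continuous_on_iff by metis
  obtain r2 where r2: "0 < r2" "\<And>x. x \<in> S \<Longrightarrow> dist x p < r2 \<Longrightarrow> dist (fv' x u) (fv' p u) < e"
    using cv S(2) e unfolding continuous_on_iff by metis
  define r where "r = min r0 (min r1 r2)"
  \<comment> \<open>With this \<open>h\<close> the whole parallelogram spanned at \<open>p\<close>
    by \<open>h *\<^sub>R u\<close> and \<open>h *\<^sub>R v\<close> stays within
    \<open>r / 2\<close> of \<open>p\<close>; the summand 1 keeps the denominator positive when both
    vectors vanish.\<close>
  define h where "h = r / (2 * (norm u + norm v + 1))"
  have r: "0 < r" using r0 r1 r2 by (simp add: r_def)
  have N: "0 < norm u + norm v + 1"
    by (simp add: add_nonneg_pos)
  have h: "0 < h" using r N by (simp add: h_def)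
  have hr: "h * (norm u + norm v + 1) = r / 2"
    using N by (simp add: h_def field_simps)
  have close: "norm (s *\<^sub>R u + t *\<^sub>R v) < r" if "0 \<le> s" "s \<le> h" "0 \<le> t" "t \<le> h" for s t
  proof -
    have "norm (s *\<^sub>R u + t *\<^sub>R v) \<le> s * norm u + t * norm v"
      using norm_triangle_ineq[of "s *\<^sub>R u" "t *\<^sub>R v"] that by simp
    also have "\<dots> \<le> h * norm u + h * norm v"
      using that by (intro add_mono mult_right_mono) auto
    also have "\<dots> \<le> r / 2"
      using hr h by (simp add: algebra_simps)
    finally show ?thesis using r by simp
  qed
  have d: "dist (p + s *\<^sub>R u + t *\<^sub>R v) p < r" if "0 \<le> s" "s \<le> h" "0 \<le> t" "t \<le> h" for s t
    using close[OF that] by (simp add: dist_norm algebra_simps)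
  have inS: "p + s *\<^sub>R u + t *\<^sub>R v \<in> S" if "0 \<le> s" "s \<le> h" "0 \<le> t" "t \<le> h" for s t
    using d[OF that] r0 by (auto simp: r_def dist_commute)
  obtain s t where st: "0 < s" "s < h" "0 < t" "t < h"
    "f (p + h *\<^sub>R u + h *\<^sub>R v) - f (p + h *\<^sub>R u) - f (p + h *\<^sub>R v) + f p
      = h * h * fu' (p + s *\<^sub>R u + t *\<^sub>R v) v"
    by (rule second_difference_mean_value[OF h inS f fu])
  have inS': "p + s *\<^sub>R v + t *\<^sub>R u \<in> S" if "0 \<le> s" "s \<le> h" "0 \<le> t" "t \<le> h" for s t
    using inS[of t s] that by (simp add: algebra_simps)
  \<comment> \<open>The same expansion with the roles of \<open>u\<close> and \<open>v\<close>
    exchanged; the left sides agree by symmetry.\<close>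
  obtain t' s' where st': "0 < t'" "t' < h" "0 < s'" "s' < h"
    "f (p + h *\<^sub>R v + h *\<^sub>R u) - f (p + h *\<^sub>R v) - f (p + h *\<^sub>R u) + f p
      = h * h * fv' (p + t' *\<^sub>R v + s' *\<^sub>R u) u"
    by (rule second_difference_mean_value[OF h inS' f fv])
  have "h * h * fu' (p + s *\<^sub>R u + t *\<^sub>R v) v = h * h * fv' (p + s' *\<^sub>R u + t' *\<^sub>R v) u"
    using st(5) st'(5) by (simp add: algebra_simps)
  then have eq: "fu' (p + s *\<^sub>R u + t *\<^sub>R v) v = fv' (p + s' *\<^sub>R u + t' *\<^sub>R v) u"
    using h by simp
  have "dist (fu' (p + s *\<^sub>R u + t *\<^sub>R v) v) (fu' p v) < e"
    using d[of s t] inS[of s t] st by (intro r1(2)) (auto simp: r_def)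
  moreover have "dist (fv' (p + s' *\<^sub>R u + t' *\<^sub>R v) u) (fv' p u) < e"
    using d[of s' t'] inS[of s' t'] st' by (intro r2(2)) (auto simp: r_def)
  ultimately show False
    unfolding eq e_def dist_real_def by argo
qed

text \<open>The mean value theorem is about real values, so the real case is applied to each
  component \<open>f x \<bullet> b\<close>.\<close>

lemma smooth_on_symmetric_derivative:
  fixes f :: "'a::euclidean_space \<Rightarrow> 'b::euclidean_space"
  assumes "open S" "p \<in> S" and f: "smooth_on S f"
  shows "frechet_derivative (\<lambda>x. frechet_derivative f (at x) u) (at p) v
       = frechet_derivative (\<lambda>x. frechet_derivative f (at x) v) (at p) u"
proof (rule euclidean_eqI)
  fix b :: 'b
  note smooth = f smooth_on_frechet_derivative[OF f]
  have cont: "continuous_on S (\<lambda>x. frechet_derivative (\<lambda>x. frechet_derivative f (at x) u) (at x) v \<bullet> b)"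
    for u v
    by (intro continuous_on_inner continuous_on_const smooth_on_continuous_on
        smooth_on_frechet_derivative f)
  show "frechet_derivative (\<lambda>x. frechet_derivative f (at x) u) (at p) v \<bullet> b
       = frechet_derivative (\<lambda>x. frechet_derivative f (at x) v) (at p) u \<bullet> b"
    by (rule symmetric_mixed_derivative_real
        [OF assms(1,2), of "\<lambda>x. f x \<bullet> b" "\<lambda>x w. frechet_derivative f (at x) w \<bullet> b" u
          "\<lambda>x w. frechet_derivative (\<lambda>x. frechet_derivative f (at x) u) (at x) w \<bullet> b" v
          "\<lambda>x w. frechet_derivative (\<lambda>x. frechet_derivative f (at x) v) (at x) w \<bullet> b"])
       (auto intro!: has_derivative_inner_left smooth smooth_on_has_derivative cont)
qed

text \<open>Expanding the argument of \<open>G q\<close> in the standard basis turns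
  \<open>G q (x q)\<close> into a finite sum of scalar functions times maps \<open>G q b\<close>, to
  which the ordinary product rule applies.\<close>

lemma has_derivative_apply_linear:
  fixes G :: "'a::real_normed_vector \<Rightarrow> 'b::euclidean_space \<Rightarrow> 'c::real_normed_vector"
  assumes S: "open S" "p \<in> S"
    and lin: "\<And>q. q \<in> S \<Longrightarrow> linear (G q)"
    and G: "\<And>w. ((\<lambda>q. G q w) has_derivative G' w) (at p)"
    and x: "(x has_derivative x') (at p)"
  shows "((\<lambda>q. G q (x q)) has_derivative (\<lambda>u. G' (x p) u + G p (x' u))) (at p)"
proof -
  have expand: "G q y = (\<Sum>b\<in>Basis. (y \<bullet> b) *\<^sub>R G q b)" if "q \<in> S" for q y
    using linear_sum[OF lin[OF that], of "\<lambda>b. (y \<bullet> b) *\<^sub>R b" Basis]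
      linear_cmul[OF lin[OF that]] by (simp add: euclidean_representation)
  have "((\<lambda>q. \<Sum>b\<in>Basis. (y \<bullet> b) *\<^sub>R G q b) has_derivative
      (\<lambda>u. \<Sum>b\<in>Basis. (y \<bullet> b) *\<^sub>R G' b u)) (at p)" for y
    by (intro derivative_intros G)
  then have "((\<lambda>q. G q y) has_derivative (\<lambda>u. \<Sum>b\<in>Basis. (y \<bullet> b) *\<^sub>R G' b u)) (at p)" for y
    by (rule has_derivative_transform_within_open[OF _ S]) (simp add: expand[symmetric])
  \<comment> \<open>Uniqueness of the derivative forces \<open>G' y\<close> to be linear in
    \<open>y\<close>; this recombines the sum over the basis into \<open>G' (x p) u\<close>
    below.\<close>
  then have G': "G' y = (\<lambda>u. \<Sum>b\<in>Basis. (y \<bullet> b) *\<^sub>R G' b u)" for y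
    using has_derivative_unique[OF G] by blast
  have "((\<lambda>q. \<Sum>b\<in>Basis. (x q \<bullet> b) *\<^sub>R G q b) has_derivative
      (\<lambda>u. \<Sum>b\<in>Basis. (x p \<bullet> b) *\<^sub>R G' b u + (x' u \<bullet> b) *\<^sub>R G p b)) (at p)"
    by (intro has_derivative_sum has_derivative_scaleR has_derivative_inner_left G x)
  then have "((\<lambda>q. G q (x q)) has_derivative
      (\<lambda>u. \<Sum>b\<in>Basis. (x p \<bullet> b) *\<^sub>R G' b u + (x' u \<bullet> b) *\<^sub>R G p b)) (at p)"
    by (rule has_derivative_transform_within_open[OF _ S]) (simp add: expand[symmetric])
  moreover have "(\<Sum>b\<in>Basis. (x p \<bullet> b) *\<^sub>R G' b u + (x' u \<bullet> b) *\<^sub>R G p b)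
      = G' (x p) u + G p (x' u)" for u
    unfolding sum.distrib using expand[OF S(2)] G'[of "x p"] by metis
  ultimately show ?thesis by simp
qed

text \<open>The inverse function theorem, applied to \<open>(q, w) \<mapsto> (q, G q w)\<close>, replaces the smoothness
  of matrix inversion.\<close>

lemma differentiable_linear_solution:
  fixes G :: "'a::euclidean_space \<Rightarrow> 'b::euclidean_space \<Rightarrow> 'b"
  assumes S: "open S" "p \<in> S"
    and lin: "\<And>q. q \<in> S \<Longrightarrow> linear (G q)"
    and inj: "\<And>q. q \<in> S \<Longrightarrow> inj (G q)"
    and G: "\<And>q w. q \<in> S \<Longrightarrow> (\<lambda>q. G q w) differentiable (at q)"
    and c: "c differentiable (at p)"
    and sol: "\<And>q. q \<in> S \<Longrightarrow> G q (x q) = c q"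
  shows "x differentiable (at p)"
proof -
  define G' where "G' q w = frechet_derivative (\<lambda>q. G q w) (at q)" for q w
  have G': "((\<lambda>q. G q w) has_derivative G' q w) (at q)" if "q \<in> S" for q w
    using G[OF that] unfolding G'_def by (simp add: frechet_derivative_works)
  define \<Phi> where "\<Phi> z = (fst z, G (fst z) (snd z))" for z
  \<comment> \<open>\<open>\<Psi>\<close> inverts \<open>\<Phi>\<close> fibre by fibre over
    \<open>S\<close>. The solution \<open>x q\<close> is the second component of
    \<open>\<Psi> (q, c q)\<close>, so differentiability of \<open>\<Psi>\<close> at
    \<open>(p, c p)\<close> is enough.\<close>
  define \<Psi> where "\<Psi> z = (fst z, inv (G (fst z)) (snd z))" for z
  have d2: "((\<lambda>z. G (fst z) (snd z)) has_derivative
      (\<lambda>u. G' (fst z) (snd z) (fst u) + G (fst z) (snd u))) (at z)" if "fst z \<in> S" for z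
  proof (rule has_derivative_apply_linear[of "S \<times> UNIV" z "\<lambda>z. G (fst z)" "\<lambda>w u. G' (fst z) w (fst u)" snd snd])
    show "open (S \<times> (UNIV::'b set))" using S by (simp add: open_Times)
    show "z \<in> S \<times> UNIV" using that by (cases z) auto
    show "linear (G (fst q))" if "q \<in> S \<times> UNIV" for q :: "'a \<times> 'b"
      using that lin by auto
    show "((\<lambda>q. G (fst q) w) has_derivative (\<lambda>u. G' (fst z) w (fst u))) (at z)" for w
      by (rule has_derivative_compose[of fst _ _ _ "\<lambda>q. G q w"])
         (auto intro!: derivative_eq_intros G' that)
    show "(snd has_derivative snd) (at z)"
      by (auto intro!: derivative_eq_intros)
  qed
  have \<Phi>: "(\<Phi> has_derivative (\<lambda>u. (fst u, G' (fst z) (snd z) (fst u) + G (fst z) (snd u)))) (at z)"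
    if "fst z \<in> S" for z
    unfolding \<Phi>_def by (intro has_derivative_Pair d2 that) (auto intro!: derivative_eq_intros)
  have surj: "surj (G p)"
    using lin inj S linear_injective_imp_surjective by blast
  have x: "x q = snd (\<Psi> (q, c q))" if "q \<in> S" for q
    using sol[OF that] inv_f_f[OF inj[OF that], of "x q"] by (simp add: \<Psi>_def)
  \<comment> \<open>The derivative of \<open>\<Phi>\<close> is block triangular with the identity
    and \<open>G p\<close> on the diagonal; solving for the second component gives the stated
    inverse.\<close>
  have "(\<Psi> has_derivative (\<lambda>u. (fst u, inv (G p) (snd u - G' p (x p) (fst u))))) (at (\<Phi> (p, x p)))"
  proof (rule has_derivative_inverse_strong[where S = "S \<times> UNIV" and x = "(p, x p)" and f = \<Phi>])
    show "open (S \<times> (UNIV::'b set))" "(p, x p) \<in> S \<times> UNIV" using S by (auto simp: open_Times)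
    show "continuous_on (S \<times> UNIV) \<Phi>"
      by (rule has_derivative_continuous_on, rule has_derivative_at_withinI, rule \<Phi>) auto
    show "\<Psi> (\<Phi> z) = z" if "z \<in> S \<times> UNIV" for z
      using that inv_f_f[OF inj] by (auto simp: \<Psi>_def \<Phi>_def)
    show "(\<Phi> has_derivative (\<lambda>u. (fst u, G' p (x p) (fst u) + G p (snd u)))) (at (p, x p))"
      using \<Phi>[of "(p, x p)"] S by simp
    show "(\<lambda>u. (fst u, G' p (x p) (fst u) + G p (snd u))) \<circ>
        (\<lambda>u. (fst u, inv (G p) (snd u - G' p (x p) (fst u)))) = id"
      using surj by (auto simp: fun_eq_iff surj_f_inv_f)
  qed
  then have "\<Psi> differentiable (at (p, c p))"
    using S sol by (auto simp: differentiable_def \<Phi>_def)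
  moreover have "(\<lambda>q. (q, c q)) differentiable (at p)"
    using c unfolding differentiable_def by (fast intro: has_derivative_Pair[OF has_derivative_ident])
  ultimately have "(\<lambda>q. \<Psi> (q, c q)) differentiable (at p)"
    using differentiable_chain_at[of "\<lambda>q. (q, c q)" p \<Psi>] by (simp add: o_def)
  then have "(\<lambda>q. snd (\<Psi> (q, c q))) differentiable (at p)"
    unfolding differentiable_def by (fast intro: has_derivative_snd)
  then obtain D where D: "((\<lambda>q. snd (\<Psi> (q, c q))) has_derivative D) (at p)"
    by (auto simp: differentiable_def)
  then have "(x has_derivative D) (at p)"
    by (rule has_derivative_transform_within_open[OF _ S]) (simp add: x)
  then show ?thesis by (auto simp: differentiable_def)
qed

subsection \<open>The Gauss equation in a chart\<close>

lemma normal_part_eqI: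
  assumes T: "subspace T" and n: "w - n \<in> T" "\<And>t. t \<in> T \<Longrightarrow> n \<bullet> t = 0"
  shows "normal_part T w = n"
  unfolding normal_part_def
proof (rule the_equality)
  show "w - n \<in> T \<and> (\<forall>t\<in>T. orthogonal n t)"
    using n by (simp add: orthogonal_def)
  fix m assume m: "w - m \<in> T \<and> (\<forall>t\<in>T. orthogonal m t)"
  \<comment> \<open>Two candidates differ by a vector that lies in \<open>T\<close> and is
    orthogonal to \<open>T\<close>, hence to itself.\<close>
  have "(w - n) - (w - m) \<in> T"
    using T n m subspace_diff by blast
  then have "m - n \<in> T" by simp
  then have "(m - n) \<bullet> (m - n) = 0"
    using n m by (simp add: inner_diff_left orthogonal_def)
  then show "m = n" by simp
qed

lemma
  assumes T: "subspace T"
  shows diff_normal_part_mem: "w - normal_part T w \<in> T"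
    and normal_part_inner: "t \<in> T \<Longrightarrow> normal_part T w \<bullet> t = 0"
proof -
  obtain y z where yz: "y \<in> span T" "\<And>t. t \<in> span T \<Longrightarrow> orthogonal z t" "w = y + z"
    using orthogonal_subspace_decomp_exists[of T w] by blast
  have T': "span T = T" using T by simp
  have z: "w - z \<in> T" "t \<in> T \<Longrightarrow> z \<bullet> t = 0" for t
    using yz unfolding T' by (auto simp: orthogonal_def)
  have "normal_part T w = z" using T z by (rule normal_part_eqI)
  then show "w - normal_part T w \<in> T" "t \<in> T \<Longrightarrow> normal_part T w \<bullet> t = 0"
    using z by auto
qed

lemma linear_normal_part:
  assumes T: "subspace T"
  shows "linear (normal_part T)"
proof
  fix v w :: 'a and r :: real
  note np = diff_normal_part_mem[OF T] normal_part_inner[OF T]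
  have "(v - normal_part T v) + (w - normal_part T w) \<in> T"
    using subspace_add[OF T np(1) np(1)] .
  then show "normal_part T (v + w) = normal_part T v + normal_part T w"
    by (intro normal_part_eqI[OF T]) (auto simp: np(2) algebra_simps)
  have "r *\<^sub>R (v - normal_part T v) \<in> T"
    using subspace_scale[OF T np(1)] .
  then show "normal_part T (r *\<^sub>R v) = r *\<^sub>R normal_part T v"
    by (intro normal_part_eqI[OF T]) (auto simp: np(2) algebra_simps)
qed

text \<open>One chart of the submanifold: \<open>F\<close> is the immersion read in coordinates on
  \<open>S\<close>. The whole computation of the curvature is done here with coordinate
  vectors.\<close>

locale parametrized_immersion =
  fixes S :: "'n::euclidean_space set" and F :: "'n \<Rightarrow> 'e::euclidean_space"
  assumes open_domain: "open S"
    and smooth: "smooth_on S F"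
    and inj_derivative: "q \<in> S \<Longrightarrow> inj (frechet_derivative F (at q))"
begin

definition D1 :: "'n \<Rightarrow> 'n \<Rightarrow> 'e" where
  "D1 q u = frechet_derivative F (at q) u"

text \<open>The first vector is the direction of the outermost derivative, so this is the flat
  derivative in direction \<open>u\<close> of the coordinate field of \<open>v\<close>.
  \<open>D3\<close> follows the same order.\<close>

definition D2 :: "'n \<Rightarrow> 'n \<Rightarrow> 'n \<Rightarrow> 'e" where
  "D2 q u v = frechet_derivative (\<lambda>q. D1 q v) (at q) u"

definition D3 :: "'n \<Rightarrow> 'n \<Rightarrow> 'n \<Rightarrow> 'n \<Rightarrow> 'e" where
  "D3 q u v w = frechet_derivative (\<lambda>q. D2 q v w) (at q) u"

lemma smooth_D1: "smooth_on S (\<lambda>q. D1 q v)"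
  unfolding D1_def by (rule smooth_on_frechet_derivative[OF smooth])

lemma smooth_D2: "smooth_on S (\<lambda>q. D2 q v w)"
  unfolding D2_def by (rule smooth_on_frechet_derivative[OF smooth_D1])

lemma D1: "q \<in> S \<Longrightarrow> (F has_derivative D1 q) (at q)"
  unfolding D1_def by (rule smooth_on_has_derivative[OF smooth])

lemma D2: "q \<in> S \<Longrightarrow> ((\<lambda>q. D1 q v) has_derivative (\<lambda>u. D2 q u v)) (at q)"
  unfolding D2_def by (rule smooth_on_has_derivative[OF smooth_D1])

lemma D3: "q \<in> S \<Longrightarrow> ((\<lambda>q. D2 q v w) has_derivative (\<lambda>u. D3 q u v w)) (at q)"
  unfolding D3_def by (rule smooth_on_has_derivative[OF smooth_D2])

lemma linear_D1: "q \<in> S \<Longrightarrow> linear (D1 q)"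
  using D1 by (rule has_derivative_linear)

lemma inj_D1: "q \<in> S \<Longrightarrow> inj (D1 q)"
  using inj_derivative unfolding D1_def by simp

lemma D2_symmetric: "q \<in> S \<Longrightarrow> D2 q u v = D2 q v u"
  unfolding D2_def D1_def by (rule smooth_on_symmetric_derivative[OF open_domain _ smooth])

text \<open>The two outer derivatives commute because \<open>\<lambda>q. D1 q w\<close> is itself
  smooth. This makes the third derivatives drop out of the curvature.\<close>

lemma D3_symmetric: "q \<in> S \<Longrightarrow> D3 q u v w = D3 q v u w"
  unfolding D3_def D2_def by (rule smooth_on_symmetric_derivative[OF open_domain _ smooth_D1])

lemma linear_D2_left: "q \<in> S \<Longrightarrow> linear (\<lambda>u. D2 q u v)"
  using D2 by (rule has_derivative_linear)

lemma linear_D2_right: "q \<in> S \<Longrightarrow> linear (D2 q u)"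
  using linear_D2_left[of q u] D2_symmetric[of q _ u] by simp

abbreviation T :: "'n \<Rightarrow> 'e set" where
  "T q \<equiv> range (D1 q)"

definition II :: "'n \<Rightarrow> 'n \<Rightarrow> 'n \<Rightarrow> 'e" where
  "II q u v = normal_part (T q) (D2 q u v)"

abbreviation \<Gamma> :: "'n \<Rightarrow> 'n \<Rightarrow> 'n \<Rightarrow> 'n" where
  "\<Gamma> \<equiv> christoffel (induced_metric F)"

lemma subspace_T: "q \<in> S \<Longrightarrow> subspace (T q)"
  using linear_D1 linear_subspace_image subspace_UNIV by blast

lemma bilinear_II: "q \<in> S \<Longrightarrow> bilinear (II q)"
  unfolding bilinear_def II_def
  by (auto intro!: linear_compose[unfolded o_def, OF _ linear_normal_part[OF subspace_T]]
      linear_D2_left linear_D2_right)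

lemma II_symmetric: "q \<in> S \<Longrightarrow> II q u v = II q v u"
  unfolding II_def by (metis D2_symmetric)

lemma induced_metric_D1: "induced_metric F q u v = D1 q u \<bullet> D1 q v"
  by (simp add: induced_metric_def D1_def)

lemma induced_metric_derivative:
  assumes q: "q \<in> S"
  shows "frechet_derivative (\<lambda>q. induced_metric F q u v) (at q) z
    = D2 q z u \<bullet> D1 q v + D1 q u \<bullet> D2 q z v"
proof -
  have "((\<lambda>q. induced_metric F q u v) has_derivative
      (\<lambda>z. D1 q u \<bullet> D2 q z v + D2 q z u \<bullet> D1 q v)) (at q)"
    unfolding induced_metric_D1 by (intro has_derivative_inner D2 q)
  then show ?thesis
    by (simp add: frechet_derivative_at[symmetric])
qed

text \<open>The difference of the two images is tangent and orthogonal to itself, hence zero, and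
  \<open>D1 q\<close> is injective. This nondegeneracy of the induced metric gives uniqueness in
  \<open>christoffel\<close> and injectivity of the Gram matrix.\<close>

lemma D1_eqI:
  assumes q: "q \<in> S" and eq: "\<And>z. D1 q w \<bullet> D1 q z = D1 q w' \<bullet> D1 q z"
  shows "w = w'"
proof -
  have "(D1 q w - D1 q w') \<bullet> D1 q (w - w') = 0"
    using eq by (simp add: inner_diff_left)
  then have "D1 q (w - w') = 0"
    by (simp add: linear_diff[OF linear_D1[OF q]])
  then show ?thesis
    using inj_D1[OF q] linear_diff[OF linear_D1[OF q]] by (auto dest: injD)
qed

text \<open>The Levi-Civita connection of an induced metric is the tangential part of the flat
  derivative: the Koszul formula determines the products of \<open>D1 q (\<Gamma> q u v)\<close>
  with tangent vectors, and they are those of \<open>D2 q u v\<close>.\<close>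

lemma D1_christoffel:
  assumes q: "q \<in> S"
  shows "D1 q (\<Gamma> q u v) = D2 q u v - II q u v"
proof -
  obtain w where w: "D2 q u v - II q u v = D1 q w"
    using diff_normal_part_mem[OF subspace_T[OF q], of "D2 q u v"] by (auto simp: II_def)
  have tang: "D1 q w \<bullet> D1 q z = D2 q u v \<bullet> D1 q z" for z
    using normal_part_inner[OF subspace_T[OF q], of "D1 q z" "D2 q u v"]
    by (simp add: w[symmetric] II_def inner_diff_left)
  \<comment> \<open>Of the six terms produced by the product rule, four cancel by symmetry of
    \<open>D2\<close> and the other two coincide.\<close>
  have koszul: "(frechet_derivative (\<lambda>q. induced_metric F q v z) (at q) u
      + frechet_derivative (\<lambda>q. induced_metric F q u z) (at q) v
      - frechet_derivative (\<lambda>q. induced_metric F q u v) (at q) z) / 2 = D2 q u v \<bullet> D1 q z" for z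
    using D2_symmetric[OF q, of u v] D2_symmetric[OF q, of u z] D2_symmetric[OF q, of v z]
    by (simp add: induced_metric_derivative[OF q] inner_commute)
  have "\<Gamma> q u v = w"
    unfolding christoffel_def koszul
  proof (rule the_equality)
    show "\<forall>z. induced_metric F q w z = D2 q u v \<bullet> D1 q z"
      by (simp add: induced_metric_D1 tang)
    show "w' = w" if "\<forall>z. induced_metric F q w' z = D2 q u v \<bullet> D1 q z" for w'
      using that tang by (intro D1_eqI[OF q]) (auto simp: induced_metric_D1)
  qed
  then show ?thesis using w by simp
qed

lemma christoffel_inner:
  assumes "q \<in> S"
  shows "D1 q (\<Gamma> q u v) \<bullet> D1 q z = D2 q u v \<bullet> D1 q z"
  using normal_part_inner[OF subspace_T[OF assms], of "D1 q z" "D2 q u v"]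
  by (simp add: D1_christoffel[OF assms] II_def inner_diff_left)

text \<open>\<open>\<Gamma> q u v\<close> solves a linear system whose matrix \<open>G q\<close> is
  the Gram matrix of the induced metric and whose right side \<open>c q\<close> lists the products
  of \<open>D2 q u v\<close> with the coordinate tangent vectors.\<close>

lemma differentiable_christoffel:
  assumes p: "p \<in> S"
  shows "(\<lambda>q. \<Gamma> q u v) differentiable (at p)"
proof -
  define G where "G q w = (\<Sum>b\<in>Basis. (D1 q w \<bullet> D1 q b) *\<^sub>R b)" for q w
  define c where "c q = (\<Sum>b\<in>Basis. (D2 q u v \<bullet> D1 q b) *\<^sub>R b)" for q
  show ?thesis
  proof (rule differentiable_linear_solution[OF open_domain p, of G c])
    fix q w assume q: "q \<in> S"
    note D1_lin = linear_add[OF linear_D1[OF q]] linear_cmul[OF linear_D1[OF q]]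
    show "linear (G q)"
      unfolding G_def
      by (rule linearI)
         (simp_all add: D1_lin inner_add_left scaleR_add_left sum.distrib scaleR_sum_right)
    show "G q (\<Gamma> q u v) = c q"
      by (simp add: G_def c_def christoffel_inner[OF q])
    have "((\<lambda>q. G q w) has_derivative
        (\<lambda>z. \<Sum>b\<in>Basis. (D1 q w \<bullet> D2 q z b + D2 q z w \<bullet> D1 q b) *\<^sub>R b)) (at q)"
      unfolding G_def
      by (intro has_derivative_sum has_derivative_scaleR_left has_derivative_inner D2 q)
    then show "(\<lambda>q. G q w) differentiable (at q)"
      unfolding differentiable_def by blast
    show "inj (G q)"
    proof (rule injI)
      fix x y assume "G q x = G q y"
      then have eq: "D1 q x \<bullet> D1 q b = D1 q y \<bullet> D1 q b" if "b \<in> Basis" for b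
        using that inner_sum_left_Basis[OF that] unfolding G_def by metis
      have D1_sum: "D1 q z = (\<Sum>b\<in>Basis. (z \<bullet> b) *\<^sub>R D1 q b)" for z
        using linear_sum[OF linear_D1[OF q], of "\<lambda>b. (z \<bullet> b) *\<^sub>R b" Basis]
        by (simp add: euclidean_representation D1_lin)
      have "D1 q x \<bullet> D1 q z = D1 q y \<bullet> D1 q z" for z
        \<comment> \<open>Only the right factors \<open>D1 q z\<close> are expanded, which reduces
          the claim to basis vectors.\<close>
        by (subst (2 4) D1_sum) (simp add: inner_sum_right eq)
      then show "x = y" by (rule D1_eqI[OF q])
    qed
  next
    have "(c has_derivative
        (\<lambda>z. \<Sum>b\<in>Basis. (D2 p u v \<bullet> D2 p z b + D3 p z u v \<bullet> D1 p b) *\<^sub>R b)) (at p)"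
      unfolding c_def
      by (intro has_derivative_sum has_derivative_scaleR_left has_derivative_inner D2 D3 p)
    then show "c differentiable (at p)"
      unfolding differentiable_def by blast
  qed
qed

text \<open>The left vector is the iterated covariant derivative of fields with constant
  coefficients. The formula results from differentiating \<open>christoffel_inner\<close> in
  direction \<open>u\<close>, where \<open>D1 p (\<Gamma> p v w)\<close> differs from
  \<open>D2 p v w\<close> by \<open>II p v w\<close>.\<close>

lemma covariant_second_derivative:
  assumes p: "p \<in> S"
  shows "D1 p (frechet_derivative (\<lambda>q. \<Gamma> q v w) (at p) u + \<Gamma> p u (\<Gamma> p v w)) \<bullet> D1 p z
    = D3 p u v w \<bullet> D1 p z + II p v w \<bullet> II p u z"
proof -
  define X where "X = frechet_derivative (\<lambda>q. \<Gamma> q v w) (at p)"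
  have X: "((\<lambda>q. \<Gamma> q v w) has_derivative X) (at p)"
    using differentiable_christoffel[OF p] unfolding X_def by (simp add: frechet_derivative_works)
  have L: "((\<lambda>q. D1 q (\<Gamma> q v w)) has_derivative (\<lambda>u. D2 p u (\<Gamma> p v w) + D1 p (X u))) (at p)"
    by (rule has_derivative_apply_linear[OF open_domain p linear_D1 D2[OF p] X])
  have "((\<lambda>q. D1 q (\<Gamma> q v w) \<bullet> D1 q z) has_derivative
      (\<lambda>u. D1 p (\<Gamma> p v w) \<bullet> D2 p u z + (D2 p u (\<Gamma> p v w) + D1 p (X u)) \<bullet> D1 p z)) (at p)"
    by (intro has_derivative_inner L D2 p)
  moreover have "((\<lambda>q. D2 q v w \<bullet> D1 q z) has_derivative
      (\<lambda>u. D2 p v w \<bullet> D2 p u z + D3 p u v w \<bullet> D1 p z)) (at p)"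
    by (intro has_derivative_inner D3 D2 p)
  then have "((\<lambda>q. D1 q (\<Gamma> q v w) \<bullet> D1 q z) has_derivative
      (\<lambda>u. D2 p v w \<bullet> D2 p u z + D3 p u v w \<bullet> D1 p z)) (at p)"
    by (rule has_derivative_transform_within_open[OF _ open_domain p]) (simp add: christoffel_inner)
  ultimately have
    "(\<lambda>u. D1 p (\<Gamma> p v w) \<bullet> D2 p u z + (D2 p u (\<Gamma> p v w) + D1 p (X u)) \<bullet> D1 p z)
      = (\<lambda>u. D2 p v w \<bullet> D2 p u z + D3 p u v w \<bullet> D1 p z)"
    by (rule has_derivative_unique)
  then have "D1 p (\<Gamma> p v w) \<bullet> D2 p u z + (D2 p u (\<Gamma> p v w) + D1 p (X u)) \<bullet> D1 p z
      = D2 p v w \<bullet> D2 p u z + D3 p u v w \<bullet> D1 p z"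
    by (rule fun_cong)
  then have "(D2 p u (\<Gamma> p v w) + D1 p (X u)) \<bullet> D1 p z
      = D3 p u v w \<bullet> D1 p z + II p v w \<bullet> D2 p u z"
    by (simp add: D1_christoffel[OF p] inner_diff_left)
  \<comment> \<open>A normal vector sees only the normal part of \<open>D2 p u z\<close>.\<close>
  moreover have "II p v w \<bullet> D2 p u z = II p v w \<bullet> II p u z"
    using normal_part_inner[OF subspace_T[OF p] diff_normal_part_mem[OF subspace_T[OF p]],
        of "D2 p v w" "D2 p u z"]
    by (simp add: II_def inner_diff_right)
  ultimately show ?thesis
    by (simp add: X_def[symmetric] linear_add[OF linear_D1[OF p]] inner_add_left christoffel_inner[OF p])
qed

text \<open>Antisymmetrising \<open>covariant_second_derivative\<close> in \<open>u\<close> and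
  \<open>v\<close> cancels the \<open>D3\<close> terms and leaves the products of
  \<open>II\<close>.\<close>

lemma gauss_equation:
  assumes p: "p \<in> S"
  shows "D1 p (curvature_operator (induced_metric F) (\<lambda>_. u) (\<lambda>_. v) (\<lambda>_. w) p) \<bullet> D1 p z
    = II p v w \<bullet> II p u z - II p u w \<bullet> II p v z"
proof -
  have const: "frechet_derivative (\<lambda>q. c) (at q) = (\<lambda>_. 0)" for c q :: 'n
    by (rule frechet_derivative_const)
  \<comment> \<open>Constant fields have zero Lie bracket, so the bracket term of the curvature
    reduces to this value.\<close>
  have "\<Gamma> p 0 w = 0"
    using D1_christoffel[OF p, of 0 w] linear_0[OF linear_D2_left[OF p]]
      linear_0[OF linear_D1[OF p]] inj_D1[OF p] linear_0[OF linear_normal_part[OF subspace_T[OF p]]]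
    by (simp add: II_def) (metis injD)
  then have "curvature_operator (induced_metric F) (\<lambda>_. u) (\<lambda>_. v) (\<lambda>_. w) p
    = (frechet_derivative (\<lambda>q. \<Gamma> q v w) (at p) u + \<Gamma> p u (\<Gamma> p v w))
      - (frechet_derivative (\<lambda>q. \<Gamma> q u w) (at p) v + \<Gamma> p v (\<Gamma> p u w))"
    by (simp add: curvature_operator_def levi_civita_def lie_bracket_def const)
  then show ?thesis
    using D3_symmetric[OF p, of u v w]
    by (simp add: linear_diff[OF linear_D1[OF p]] inner_diff_left covariant_second_derivative[OF p])
qed

end

subsection \<open>Traces and orthogonal decompositions\<close>

lemma orthonormal_basis_some_onb: "subspace V \<Longrightarrow> orthonormal_basis V (some_onb V)"
  unfolding some_onb_def
  by (rule someI_ex, erule orthonormal_basis_subspace) (auto simp: orthonormal_basis_def)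

lemma orthonormal_basis_independent:
  assumes "orthonormal_basis V B"
  shows "independent B"
  using assms unfolding orthonormal_basis_def
  by (intro pairwise_orthogonal_independent) auto

lemma orthonormal_basis_finite: "orthonormal_basis V B \<Longrightarrow> finite B"
  by (rule independent_imp_finite[OF orthonormal_basis_independent])

lemma orthonormal_basis_card:
  assumes "orthonormal_basis V B"
  shows "card B = dim V"
  using dim_eq_card_independent[OF orthonormal_basis_independent[OF assms]] assms
  by (metis dim_span orthonormal_basis_def)

lemma orthonormal_basis_expansion:
  assumes B: "orthonormal_basis V B" and x: "x \<in> V"
  shows "x = (\<Sum>b\<in>B. (x \<bullet> b) *\<^sub>R b)"
proof -
  have fin: "finite B" using B by (rule orthonormal_basis_finite)
  obtain c where c: "x = (\<Sum>b\<in>B. c b *\<^sub>R b)"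
    using x B unfolding orthonormal_basis_def by (auto simp: span_finite[OF fin])
  have "x \<bullet> b = c b" if b: "b \<in> B" for b
  proof -
    have "x \<bullet> b = (\<Sum>a\<in>B. c a * (a \<bullet> b))"
      by (simp add: c inner_sum_left)
    also have "\<dots> = (\<Sum>a\<in>B. if a = b then c b else 0)"
      using B b unfolding orthonormal_basis_def pairwise_def orthogonal_def
      by (intro sum.cong) (auto simp: norm_eq_1)
    finally show ?thesis using fin b by simp
  qed
  then show ?thesis using c by simp
qed

text \<open>Expanding one argument of \<open>h\<close> in the other basis turns both traces into the
  same double sum over \<open>B\<close> and \<open>C\<close>. Thus the trace over
  \<open>some_onb D\<close> may be computed in a basis adapted to a decomposition of
  \<open>D\<close>.\<close>

lemma trace_orthonormal_basis_unique:
  assumes h: "bilinear h" and B: "orthonormal_basis V B" and C: "orthonormal_basis V C"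
  shows "(\<Sum>e\<in>B. h e e) = (\<Sum>e\<in>C. h e e)"
proof -
  have C_V: "C \<subseteq> V" and B_V: "B \<subseteq> V"
    using B C unfolding orthonormal_basis_def by auto
  have "h e e = (\<Sum>c\<in>C. (e \<bullet> c) *\<^sub>R h e c)" if "e \<in> B" for e
  proof -
    have "h e (\<Sum>c\<in>C. (e \<bullet> c) *\<^sub>R c) = (\<Sum>c\<in>C. (e \<bullet> c) *\<^sub>R h e c)"
      using linear_sum[of "h e" "\<lambda>c. (e \<bullet> c) *\<^sub>R c" C] h
      by (simp add: bilinear_def bilinear_rmul[OF h])
    then show ?thesis
      using orthonormal_basis_expansion[OF C subsetD[OF B_V that]] by simp
  qed
  then have "(\<Sum>e\<in>B. h e e) = (\<Sum>e\<in>B. \<Sum>c\<in>C. (e \<bullet> c) *\<^sub>R h e c)"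
    by simp
  also have "\<dots> = (\<Sum>c\<in>C. \<Sum>e\<in>B. (e \<bullet> c) *\<^sub>R h e c)"
    by (rule sum.swap)
  also have "\<dots> = (\<Sum>c\<in>C. h c c)"
  proof (rule sum.cong[OF refl])
    fix c assume c: "c \<in> C"
    have "h (\<Sum>e\<in>B. (c \<bullet> e) *\<^sub>R e) c = (\<Sum>e\<in>B. (c \<bullet> e) *\<^sub>R h e c)"
      using linear_sum[of "\<lambda>x. h x c" "\<lambda>e. (c \<bullet> e) *\<^sub>R e" B] h
      by (simp add: bilinear_def bilinear_lmul[OF h])
    then show "(\<Sum>e\<in>B. (e \<bullet> c) *\<^sub>R h e c) = h c c"
      using orthonormal_basis_expansion[OF B subsetD[OF C_V c]] by (simp add: inner_commute)
  qed
  finally show ?thesis .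
qed

text \<open>These are the off-diagonal terms of the expanded squared norm of the sum. When the
  vectors add up to zero, only the negative squares remain on the right.\<close>

lemma two_sum_inner_pairs:
  fixes a :: "nat \<Rightarrow> 'e::real_inner"
  shows "2 * (\<Sum>j<n. \<Sum>i<j. a i \<bullet> a j) = (norm (\<Sum>i<n. a i))\<^sup>2 - (\<Sum>i<n. (norm (a i))\<^sup>2)"
proof (induction n)
  case (Suc n)
  have "(norm (\<Sum>i<Suc n. a i))\<^sup>2
      = (norm (\<Sum>i<n. a i))\<^sup>2 + 2 * ((\<Sum>i<n. a i) \<bullet> a n) + (norm (a n))\<^sup>2"
    using dot_norm[of "\<Sum>i<n. a i" "a n"] by simp
  with Suc show ?case
    by (simp add: inner_sum_left)
qed simp

text \<open>The subspaces are chosen one at a time, each inside the orthogonal complement in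
  \<open>D\<close> of the earlier ones. Existence keeps the supremum in \<open>delta_max\<close>
  from being taken over the empty set.\<close>

lemma orthogonal_subspaces_exist:
  assumes "subspace D" "sum_list ns \<le> dim D"
  shows "\<exists>Vs. orthogonal_subspaces D ns Vs"
  using assms
proof (induction ns arbitrary: D)
  case Nil
  then show ?case by (simp add: orthogonal_subspaces_def)
next
  case (Cons n ns)
  obtain V where V: "subspace V" "V \<subseteq> D" "dim V = n"
    using choose_subspace_of_subspace[of n D] Cons.prems by (auto simp: span_eq_iff[THEN iffD2])
  \<comment> \<open>The complement of \<open>V\<close> in \<open>D\<close> loses exactly
    \<open>n\<close> dimensions, which leaves room for the remaining \<open>ns\<close>.\<close>
  define D' where "D' = {y \<in> D. \<forall>x\<in>V. orthogonal x y}"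
  have "dim D' + n = dim D"
    using dim_subspace_orthogonal_to_vectors[OF V(1) Cons.prems(1) V(2)] V by (simp add: D'_def)
  moreover have D': "subspace D'"
    using Cons.prems(1) unfolding D'_def subspace_def orthogonal_def
    by (auto simp: inner_add_right)
  ultimately obtain Vs where Vs: "orthogonal_subspaces D' ns Vs"
    using Cons.IH[of D'] Cons.prems by auto
  have "orthogonal_subspaces D (n # ns) (V # Vs)"
    unfolding orthogonal_subspaces_def
  proof (intro conjI allI impI ballI)
    show "length (V # Vs) = length (n # ns)"
      using Vs by (simp add: orthogonal_subspaces_def)
    fix i assume i: "i < length (n # ns)"
    show "subspace ((V # Vs) ! i)" "(V # Vs) ! i \<subseteq> D" "dim ((V # Vs) ! i) = (n # ns) ! i"
      using V Vs i by (cases i; force simp: orthogonal_subspaces_def D'_def)+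
    fix j u v
    assume j: "j < length (n # ns)" "i \<noteq> j" and uv: "u \<in> (V # Vs) ! i" "v \<in> (V # Vs) ! j"
    show "orthogonal u v"
    proof (cases i)
      case 0
      then obtain j' where j': "j = Suc j'" using j by (cases j) auto
      then have "v \<in> D'"
        using Vs j uv by (auto simp: orthogonal_subspaces_def)
      then show ?thesis using 0 uv by (auto simp: D'_def)
    next
      case (Suc i')
      show ?thesis
      proof (cases j)
        case 0
        have "u \<in> D'"
          using Vs i Suc uv by (auto simp: orthogonal_subspaces_def)
        then show ?thesis using 0 uv by (auto simp: D'_def orthogonal_commute)
      next
        case (Suc j')
        then show ?thesis
          using Vs i \<open>i = Suc i'\<close> j uv by (auto simp: orthogonal_subspaces_def)
      qed
    qed
  qed
  then show ?case by blast
qed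

text \<open>Bases of different members are orthogonal, and a unit vector is not orthogonal to
  itself, so they are disjoint. If the dimensions add up to \<open>dim D\<close>, their union
  consists of \<open>dim D\<close> independent vectors of \<open>D\<close> and therefore spans
  it.\<close>

lemma
  assumes D: "subspace D" and Vs: "orthogonal_subspaces D ns Vs"
  shows some_onb_orthogonal_disjoint:
      "\<lbrakk>i < length Vs; j < length Vs; i \<noteq> j\<rbrakk> \<Longrightarrow> some_onb (Vs ! i) \<inter> some_onb (Vs ! j) = {}"
    and orthonormal_basis_Union:
      "sum_list ns = dim D \<Longrightarrow> orthonormal_basis D (\<Union>i<length Vs. some_onb (Vs ! i))"
proof -
  let ?B = "\<lambda>i. some_onb (Vs ! i)"
  have len: "length Vs = length ns" using Vs by (simp add: orthogonal_subspaces_def)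
  have sub: "Vs ! i \<subseteq> D" and dim: "dim (Vs ! i) = ns ! i"
    and onb: "orthonormal_basis (Vs ! i) (?B i)" if "i < length Vs" for i
    using that Vs by (auto simp: orthogonal_subspaces_def intro!: orthonormal_basis_some_onb)
  have orth: "orthogonal u v" if "i < length Vs" "j < length Vs" "i \<noteq> j" "u \<in> ?B i" "v \<in> ?B j" for i j u v
  proof -
    have "u \<in> Vs ! i" "v \<in> Vs ! j"
      using that onb unfolding orthonormal_basis_def by blast+
    then show ?thesis
      using Vs that len unfolding orthogonal_subspaces_def by metis
  qed
  show disj: "?B i \<inter> ?B j = {}" if ij: "i < length Vs" "j < length Vs" "i \<noteq> j" for i j
  proof (rule ccontr)
    assume "?B i \<inter> ?B j \<noteq> {}"
    then obtain e where e: "e \<in> ?B i" "e \<in> ?B j" by blast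
    then have "e = 0" using orth[OF ij e] by (simp add: orthogonal_self)
    then show False using onb[OF ij(1)] e unfolding orthonormal_basis_def by auto
  qed
  assume total: "sum_list ns = dim D"
  let ?U = "\<Union>i<length Vs. ?B i"
  have U_D: "?U \<subseteq> D"
    using onb sub unfolding orthonormal_basis_def by fast
  have pw: "pairwise orthogonal ?U"
  proof (rule pairwiseI)
    fix u v assume uv: "u \<in> ?U" "v \<in> ?U" "u \<noteq> v"
    then obtain i j where ij: "i < length Vs" "j < length Vs" "u \<in> ?B i" "v \<in> ?B j" by blast
    show "orthogonal u v"
    proof (cases "i = j")
      case True
      then show ?thesis
        using onb[OF ij(1)] ij uv unfolding orthonormal_basis_def pairwise_def by blast
    qed (use orth ij in blast)
  qed
  have norm: "norm e = 1" if "e \<in> ?U" for e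
    using that onb unfolding orthonormal_basis_def by blast
  have indep: "independent ?U"
    using norm by (intro pairwise_orthogonal_independent[OF pw]) force
  have "card ?U = (\<Sum>i<length Vs. card (?B i))"
    using disj onb by (intro card_UN_disjoint) (auto intro: orthonormal_basis_finite[OF onb])
  also have "\<dots> = (\<Sum>i<length ns. ns ! i)"
    by (intro sum.cong) (auto simp: len[symmetric] dim orthonormal_basis_card[OF onb])
  finally have "card ?U = dim D"
    using total by (simp add: sum_list_sum_nth atLeast0LessThan)
  then have "D \<subseteq> span ?U"
    using card_eq_dim[OF U_D _ independent_imp_finite[OF indep]] indep by blast
  then have "span ?U = D"
    using span_minimal[OF U_D D] by (rule equalityI[rotated])
  then show "orthonormal_basis D ?U"
    unfolding orthonormal_basis_def using U_D pw norm by blast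
qed

section \<open>Dimension tuples entering \<open>delta_min_k\<close>\<close>

lemma finite_positive_tuples: "finite (positive_tuples d k)"
proof (rule finite_subset)
  show "positive_tuples d k \<subseteq> {ns. set ns \<subseteq> {..d} \<and> length ns = k}"
    unfolding positive_tuples_def using member_le_sum_list by force
qed (simp add: finite_lists_length_eq)

text \<open>The sign estimate concerns tuples that exhaust \<open>d\<close>, whereas
  \<open>delta_min_k\<close> runs over all sums up to \<open>d\<close>; a single exhausting tuple
  bounds the minimum.\<close>

lemma total_tuple_exists:
  assumes "0 < k" "k \<le> d"
  obtains ns where "ns \<in> positive_tuples d k" "sum_list ns = d"
proof
  \<comment> \<open>All entries but the first are 1; the first takes the rest, which is positive
    because \<open>k \<le> d\<close>.\<close>
  let ?ns = "(d - (k - 1)) # replicate (k - 1) 1"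
  show "sum_list ?ns = d"
    using assms by (simp add: sum_list_replicate)
  then show "?ns \<in> positive_tuples d k"
    using assms unfolding positive_tuples_def by auto
qed

subsection \<open>Mutual curvature of submanifolds\<close>

lemma chart_at_mem:
  assumes "smooth_manifold M A" "x \<in> topspace M"
  obtains U \<phi> where "chart_at A x = (U, \<phi>)" "(U, \<phi>) \<in> A" "x \<in> \<phi> ` U"
proof -
  have "x \<in> (\<Union>(U, \<phi>)\<in>A. \<phi> ` U)"
    using assms unfolding smooth_manifold_def by blast
  then have "\<exists>c. case c of (U, \<phi>) \<Rightarrow> (U, \<phi>) \<in> A \<and> x \<in> \<phi> ` U"
    by auto
  then have "case chart_at A x of (U, \<phi>) \<Rightarrow> (U, \<phi>) \<in> A \<and> x \<in> \<phi> ` U"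
    unfolding chart_at_def by (rule someI_ex)
  then show thesis using that by (cases "chart_at A x") auto
qed

lemma parametrized_immersion_at:
  assumes "immersed_submanifold M A f" "x \<in> topspace M"
  obtains U where "parametrized_immersion U (local_immersion A f x)" "coord_at A x \<in> U"
proof -
  obtain U \<phi> where c: "chart_at A x = (U, \<phi>)" "(U, \<phi>) \<in> A" "x \<in> \<phi> ` U"
    using chart_at_mem assms unfolding immersed_submanifold_def by metis
  have "open U" "smooth_on U (f \<circ> \<phi>)" "\<And>p. p \<in> U \<Longrightarrow> inj (frechet_derivative (f \<circ> \<phi>) (at p))"
    using assms c unfolding immersed_submanifold_def smooth_manifold_def smooth_immersion_def by fast+
  then have "parametrized_immersion U (local_immersion A f x)"
    unfolding local_immersion_def c by unfold_locales auto
  moreover have "coord_at A x \<in> U"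
    unfolding coord_at_def c using c(3) by (simp add: inv_into_into)
  ultimately show thesis by (rule that)
qed

lemma subspace_tangent_space:
  assumes "immersed_submanifold M A f" "x \<in> topspace M"
  shows "subspace (tangent_space A f x)"
proof -
  obtain U where U: "parametrized_immersion U (local_immersion A f x)" "coord_at A x \<in> U"
    using parametrized_immersion_at[OF assms] .
  interpret P: parametrized_immersion U "local_immersion A f x" by fact
  show ?thesis
    using P.subspace_T[OF U(2)] unfolding tangent_space_def tangent_map_def P.D1_def .
qed

text \<open>The coordinate expression of the second fundamental form is extended beyond the tangent space
  along a linear left inverse of the tangent map, which makes it bilinear on the whole space.\<close>

lemma gauss_equation_at:
  fixes f :: "'m \<Rightarrow> 'e::euclidean_space"
  assumes "immersed_submanifold M A f" "x \<in> topspace M"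
  obtains h :: "'e \<Rightarrow> 'e \<Rightarrow> 'e" where "bilinear h" "\<And>X Y. h X Y = h Y X"
    "\<And>X Y. \<lbrakk>X \<in> tangent_space A f x; Y \<in> tangent_space A f x\<rbrakk>
      \<Longrightarrow> second_fundamental_form A f x X Y = h X Y"
    "\<And>X Y Z W. \<lbrakk>X \<in> tangent_space A f x; Y \<in> tangent_space A f x; Z \<in> tangent_space A f x;
        W \<in> tangent_space A f x\<rbrakk>
      \<Longrightarrow> curvature_tensor A f x X Y Z \<bullet> W = h Y Z \<bullet> h X W - h X Z \<bullet> h Y W"
proof -
  obtain U where U: "parametrized_immersion U (local_immersion A f x)" and p: "coord_at A x \<in> U"
    using parametrized_immersion_at[OF assms] .
  interpret P: parametrized_immersion U "local_immersion A f x" by fact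
  let ?p = "coord_at A x"
  have tm: "tangent_map A f x = P.D1 ?p"
    by (simp add: fun_eq_iff tangent_map_def P.D1_def)
  then have ts: "tangent_space A f x = range (P.D1 ?p)"
    by (simp add: tangent_space_def)
  obtain L where L: "linear L" "L \<circ> P.D1 ?p = id"
    using linear_injective_left_inverse[OF P.linear_D1[OF p] P.inj_D1[OF p]] by blast
  have L_D1: "L (P.D1 ?p u) = u" for u
    using L(2) by (simp add: fun_eq_iff)
  have coord: "coord_vec A f x X = L X" if "X \<in> tangent_space A f x" for X
    using that unfolding ts coord_vec_def tm by (auto simp: L_D1 P.inj_D1[OF p])
  have D1_L: "P.D1 ?p (L X) = X" if "X \<in> tangent_space A f x" for X
    using that unfolding ts by (auto simp: L_D1)
  define h where "h X Y = P.II ?p (L X) (L Y)" for X Y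
  show thesis
  proof
    show "bilinear h"
      unfolding bilinear_def h_def
      using P.bilinear_II[OF p, unfolded bilinear_def]
      by (auto intro: linear_compose[OF L(1), unfolded o_def])
    show "h X Y = h Y X" for X Y
      unfolding h_def by (rule P.II_symmetric[OF p])
    show "second_fundamental_form A f x X Y = h X Y"
      if "X \<in> tangent_space A f x" "Y \<in> tangent_space A f x" for X Y
      using that by (simp add: second_fundamental_form_def h_def coord P.II_def P.D2_def P.D1_def ts)
    show "curvature_tensor A f x X Y Z \<bullet> W = h Y Z \<bullet> h X W - h X Z \<bullet> h Y W"
      if "X \<in> tangent_space A f x" "Y \<in> tangent_space A f x" "Z \<in> tangent_space A f x"
        "W \<in> tangent_space A f x" for X Y Z W
      using P.gauss_equation[OF p, of "L X" "L Y" "L Z" "L W"] that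
      by (simp add: curvature_tensor_def tm coord h_def D1_L)
  qed
qed

lemma subspace_holomorphic_distribution:
  assumes "subspace (tangent_space A f x)"
  shows "subspace (holomorphic_distribution A f x)"
proof -
  have "linear (cplx_J :: complex ^ 'q \<Rightarrow> _)"
    by (rule linearI) (simp_all add: cplx_J_def vec_eq_iff algebra_simps)
  then show ?thesis
    unfolding holomorphic_distribution_def using assms
    by (intro subspace_inter linear_subspace_image)
qed

section \<open>Sign and lower bound of the mutual curvature at a point\<close>

lemma inner_sum_sum: "sum f I \<bullet> sum g J = (\<Sum>i\<in>I. \<Sum>j\<in>J. f i \<bullet> g j)"
  by (subst inner_sum_left) (simp add: inner_sum_right)

text \<open>The Gauss equation at \<open>a, b, b, a\<close> splits each summand; summing over both
  bases turns the first part into the inner product of the two partial traces.\<close>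

lemma mutual_curvature2_gauss:
  assumes V: "subspace V" "V \<subseteq> T" and W: "subspace W" "W \<subseteq> T"
    and sym: "\<And>X Y. h X Y = h Y X"
    and gauss: "\<And>X Y Z W. \<lbrakk>X \<in> T; Y \<in> T; Z \<in> T; W \<in> T\<rbrakk>
      \<Longrightarrow> curvature_tensor A f x X Y Z \<bullet> W = h Y Z \<bullet> h X W - h X Z \<bullet> h Y W"
  shows "mutual_curvature2 A f x V W
    = (\<Sum>a\<in>some_onb V. h a a) \<bullet> (\<Sum>b\<in>some_onb W. h b b)
      - (\<Sum>a\<in>some_onb V. \<Sum>b\<in>some_onb W. (norm (h a b))\<^sup>2)"
proof -
  have "some_onb V \<subseteq> T" "some_onb W \<subseteq> T"
    using orthonormal_basis_some_onb V W unfolding orthonormal_basis_def by blast+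
  then have "curvature_tensor A f x a b b \<bullet> a = h a a \<bullet> h b b - (norm (h a b))\<^sup>2"
    if "a \<in> some_onb V" "b \<in> some_onb W" for a b
    using that gauss[of a b b a] sym[of b a]
    by (auto simp: power2_norm_eq_inner inner_commute subset_iff)
  then show ?thesis
    by (simp add: mutual_curvature2_def inner_sum_sum sum_subtractf)
qed

text \<open>The situation at one point: \<open>T\<close> stands for the tangent space,
  \<open>D\<close> for the distribution and \<open>h\<close> for the bilinear extension of the
  second fundamental form.\<close>

context
  fixes A :: "('n::euclidean_space, 'm) param set" and f :: "'m \<Rightarrow> 'e::euclidean_space"
    and x :: 'm and T D :: "'e set" and h :: "'e \<Rightarrow> 'e \<Rightarrow> 'e"
  assumes D: "subspace D" "D \<subseteq> T"
    and h: "bilinear h" "\<And>X Y. h X Y = h Y X"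
    and gauss: "\<And>X Y Z W. \<lbrakk>X \<in> T; Y \<in> T; Z \<in> T; W \<in> T\<rbrakk>
      \<Longrightarrow> curvature_tensor A f x X Y Z \<bullet> W = h Y Z \<bullet> h X W - h X Z \<bullet> h Y W"
begin

lemma mutual_curvature2_orthogonal_subspaces:
  assumes "orthogonal_subspaces D ns Vs" "i < length ns" "j < length ns"
  shows "mutual_curvature2 A f x (Vs ! i) (Vs ! j)
    = (\<Sum>a\<in>some_onb (Vs ! i). h a a) \<bullet> (\<Sum>b\<in>some_onb (Vs ! j). h b b)
      - (\<Sum>a\<in>some_onb (Vs ! i). \<Sum>b\<in>some_onb (Vs ! j). (norm (h a b))\<^sup>2)"
  using assms D by (intro mutual_curvature2_gauss[OF _ _ _ _ h(2) gauss])
    (auto simp: orthogonal_subspaces_def)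

lemma mutual_curvature_nonpos:
  assumes Vs: "orthogonal_subspaces D ns Vs" and total: "sum_list ns = dim D"
    and minimal: "(\<Sum>e\<in>some_onb D. h e e) = 0"
  shows "mutual_curvature A f x Vs \<le> 0"
proof -
  define H where "H i = (\<Sum>a\<in>some_onb (Vs ! i). h a a)" for i
  have len: "length Vs = length ns" using Vs by (simp add: orthogonal_subspaces_def)
  have fin: "finite (some_onb (Vs ! i))" if "i < length Vs" for i
    using that Vs by (intro orthonormal_basis_finite[OF orthonormal_basis_some_onb])
      (auto simp: orthogonal_subspaces_def)
  \<comment> \<open>The partial traces are collected over the union of the bases, which is an
    orthonormal basis of \<open>D\<close>.\<close>
  have "(\<Sum>i<length Vs. H i) = (\<Sum>e\<in>(\<Union>i<length Vs. some_onb (Vs ! i)). h e e)"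
    unfolding H_def using fin some_onb_orthogonal_disjoint[OF D(1) Vs]
    by (intro sum.UNION_disjoint[symmetric]) auto
  also have "\<dots> = (\<Sum>e\<in>some_onb D. h e e)"
    by (rule trace_orthonormal_basis_unique[OF h(1) orthonormal_basis_Union[OF D(1) Vs total]
        orthonormal_basis_some_onb[OF D(1)]])
  finally have H0: "(\<Sum>i<length Vs. H i) = 0" using minimal by simp
  have "mutual_curvature A f x Vs \<le> (\<Sum>j<length Vs. \<Sum>i<j. H i \<bullet> H j)"
    unfolding mutual_curvature_def
    by (intro sum_mono)
       (simp add: mutual_curvature2_orthogonal_subspaces[OF Vs] len[symmetric] H_def sum_nonneg)
  also have "\<dots> \<le> 0"
    using two_sum_inner_pairs[of H "length Vs"] sum_nonneg[of "{..<length Vs}" "\<lambda>i. (norm (H i))\<^sup>2"]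
    unfolding H0 by simp
  finally show ?thesis .
qed

text \<open>An infimum of reals lies below a given member only if the set is bounded below. The
  bound is uniform since \<open>h\<close> is bounded on unit vectors and \<open>ns\<close> fixes the
  sizes of the bases.\<close>

lemma mutual_curvature_bdd_below:
  "bdd_below (mutual_curvature A f x ` {Vs. orthogonal_subspaces D ns Vs})"
proof -
  obtain B where B: "0 < B" "\<And>x y. norm (h x y) \<le> B * norm x * norm y"
    using bilinear_bounded_pos[OF h(1)] by blast
  \<comment> \<open>Each pair of basis vectors contributes at least
    \<open>- (2 * B\<^sup>2)\<close>, one \<open>B\<^sup>2\<close> for the product of
    \<open>h a a\<close> and \<open>h b b\<close> and one for the square of \<open>h a b\<close>;
    there are \<open>ns ! i * ns ! j\<close> such pairs.\<close>
  define C where "C = (\<Sum>j<length ns. \<Sum>i<j. - (2 * B\<^sup>2 * real (ns ! i) * real (ns ! j)))"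
  have "C \<le> mutual_curvature A f x Vs" if Vs: "orthogonal_subspaces D ns Vs" for Vs
  proof -
    have len: "length Vs = length ns" using Vs by (simp add: orthogonal_subspaces_def)
    have "- (2 * B\<^sup>2 * real (ns ! i) * real (ns ! j)) \<le> mutual_curvature2 A f x (Vs ! i) (Vs ! j)"
      if ij: "i < length ns" "j < length ns" for i j
    proof -
      let ?U = "some_onb (Vs ! i)" and ?V = "some_onb (Vs ! j)"
      have onb: "orthonormal_basis (Vs ! k) (some_onb (Vs ! k))" and dim: "dim (Vs ! k) = ns ! k"
        if "k < length ns" for k
        using that Vs by (auto simp: orthogonal_subspaces_def intro!: orthonormal_basis_some_onb)
      have hB: "norm (h a b) \<le> B" if "norm a = 1" "norm b = 1" for a b
        using B(2)[of a b] that by simp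
      have unit: "norm a = 1" if "a \<in> ?U \<union> ?V" for a
        using that onb ij unfolding orthonormal_basis_def by blast
      have "- (2 * B\<^sup>2) \<le> h a a \<bullet> h b b - (norm (h a b))\<^sup>2" if ab: "a \<in> ?U" "b \<in> ?V" for a b
      proof -
        have "\<bar>h a a \<bullet> h b b\<bar> \<le> norm (h a a) * norm (h b b)"
          by (rule Cauchy_Schwarz_ineq2)
        also have "\<dots> \<le> B * B"
          using ab unit B(1) by (intro mult_mono hB) auto
        finally have "\<bar>h a a \<bullet> h b b\<bar> \<le> B\<^sup>2" by (simp add: power2_eq_square)
        moreover have "(norm (h a b))\<^sup>2 \<le> B\<^sup>2"
          using ab unit by (intro power_mono hB) auto
        ultimately show ?thesis by simp
      qed
      then have "(\<Sum>a\<in>?U. \<Sum>b\<in>?V. - (2 * B\<^sup>2))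
          \<le> (\<Sum>a\<in>?U. \<Sum>b\<in>?V. h a a \<bullet> h b b - (norm (h a b))\<^sup>2)"
        by (intro sum_mono)
      moreover have "card ?U = ns ! i" "card ?V = ns ! j"
        using orthonormal_basis_card[OF onb] dim ij by auto
      ultimately show ?thesis
        unfolding mutual_curvature2_orthogonal_subspaces[OF Vs ij]
        by (simp add: inner_sum_sum sum_subtractf mult_ac)
    qed
    then show ?thesis
      unfolding C_def mutual_curvature_def len by (intro sum_mono) auto
  qed
  then show ?thesis by (intro bdd_belowI[of _ C]) auto
qed

end

theorem corollary5:
  fixes M :: "'m topology"
    and A :: "('n::euclidean_space, 'm) param set"
    and f :: "'m \<Rightarrow> complex ^ 'q"
    and d l :: nat
  assumes "CR_submanifold d l M A f"
    and "D_minimal M A f"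
  shows "\<not> ((\<exists>ns. 2 \<le> length ns \<and> (\<forall>n\<in>set ns. 0 < n) \<and> sum_list ns = d \<and>
                (\<forall>x\<in>topspace M. 0 < delta_max A f ns x))
          \<or> (\<exists>k. 2 \<le> k \<and> k \<le> d \<and> (\<forall>x\<in>topspace M. 0 < delta_min_k d A f k x)))"
proof -
  have imm: "immersed_submanifold M A f"
    using assms(1) by (simp add: CR_submanifold_def)
  then obtain x where x: "x \<in> topspace M"
    unfolding immersed_submanifold_def smooth_manifold_def by blast
  define D where "D = holomorphic_distribution A f x"
  have dim_D: "dim D = d"
    using assms(1) x unfolding CR_submanifold_def D_def by blast
  have D: "subspace D" "D \<subseteq> tangent_space A f x"
    using subspace_holomorphic_distribution[OF subspace_tangent_space[OF imm x]]
    by (auto simp: D_def holomorphic_distribution_def)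
  obtain h where h: "bilinear h" "\<And>X Y. h X Y = h Y X"
    and sff: "\<And>X Y. \<lbrakk>X \<in> tangent_space A f x; Y \<in> tangent_space A f x\<rbrakk>
      \<Longrightarrow> second_fundamental_form A f x X Y = h X Y"
    and gauss: "\<And>X Y Z W. \<lbrakk>X \<in> tangent_space A f x; Y \<in> tangent_space A f x;
        Z \<in> tangent_space A f x; W \<in> tangent_space A f x\<rbrakk>
      \<Longrightarrow> curvature_tensor A f x X Y Z \<bullet> W = h Y Z \<bullet> h X W - h X Z \<bullet> h Y W"
    by (rule gauss_equation_at[OF imm x], rule that)
  have "some_onb D \<subseteq> tangent_space A f x"
    using orthonormal_basis_some_onb[OF D(1)] D(2) unfolding orthonormal_basis_def by blast
  \<comment> \<open>On tangent vectors \<open>h\<close> is the second fundamental form, so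
    minimality becomes a statement about the trace of \<open>h\<close>.\<close>
  then have "(\<Sum>e\<in>some_onb D. h e e) = H_D A f x"
    unfolding H_D_def D_def[symmetric] by (intro sum.cong) (auto simp: sff)
  then have minimal: "(\<Sum>e\<in>some_onb D. h e e) = 0"
    using assms(2) x by (simp add: D_minimal_def)
  have nonpos: "mutual_curvature A f x Vs \<le> 0"
    if "orthogonal_subspaces D ns Vs" "sum_list ns = d" for ns Vs
    using mutual_curvature_nonpos[OF D h gauss that(1) _ minimal] that(2) dim_D by simp
  have ex: "\<exists>Vs. orthogonal_subspaces D ns Vs" if "sum_list ns = d" for ns
    using orthogonal_subspaces_exist[OF D(1)] that dim_D by simp
  have "delta_max A f ns x \<le> 0" if "sum_list ns = d" for ns
    unfolding delta_max_def D_def[symmetric]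
    using ex[OF that] nonpos that by (intro cSup_least) auto
  moreover have "delta_min_k d A f k x \<le> 0" if k: "2 \<le> k" "k \<le> d" for k
  proof -
    obtain ns where ns: "ns \<in> positive_tuples d k" "sum_list ns = d"
      using total_tuple_exists[of k d] k by auto
    obtain Vs where Vs: "orthogonal_subspaces D ns Vs" using ex[OF ns(2)] by blast
    \<comment> \<open>Passing from the minimum over tuples to the exhausting tuple, then from the
      infimum to one family, reaches a mutual curvature with known sign.\<close>
    have "delta_min_k d A f k x \<le> delta_min A f ns x"
      unfolding delta_min_k_def using ns by (intro Min_le) (auto simp: finite_positive_tuples)
    also have "\<dots> \<le> mutual_curvature A f x Vs"
      unfolding delta_min_def D_def[symmetric]
      using mutual_curvature_bdd_below[OF D h gauss] Vs by (intro cInf_lower) auto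
    also have "\<dots> \<le> 0" using nonpos Vs ns(2) by blast
    finally show ?thesis .
  qed
  ultimately show ?thesis using x not_le by blast
qed

end
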